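(* Let $\lambda\in\sigma_{ell}(J_T)$, $\alpha>1$, and $u_n=\mathrm{Im}(\varphi_n(\lambda))\,\omega_n(\lambda)$. Then there are real $\widetilde{\eta}_s,\widetilde{\zeta}_s$, $s\in\{0,\dots,T-1\}$ (functions of $\lambda$, independent of $n$), such that, writing $n=T(k-1)+s$ with $s\in\{0,\dots,T-1\}$, $$u_n=\frac{\widetilde{\eta}_s\sin\left(n\theta(\lambda)/T+\widetilde{\zeta}_s\right)}{n^{\alpha-1}}+O\left(\frac{1}{n^{\alpha}}\right),\qquad n\to\infty .$$ Moreover, the vector $(\widetilde{\eta}_s)_{s=0}^{T-1}$ is equal to the product of the scalar $C(\lambda;T)$ with some non-zero vector; therefore the only source of vanishing of the leading terms in $u_n$ is the vanishing of $C(\lambda;T)$, i.e. $(\widetilde\eta_s)_{s=0}^{T-1}$ is the zero vector only if $C(\lambda;T)=0$.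
   Context: Let $T\ge1$, $a_1,\dots,a_T>0$, extended periodically by $a_{n+T}=a_n$, so in particular $a_0=a_T$. $J_T$ is the $T$-periodic Jacobi operator on $l^2(\mathbb{N};\mathbb{C})$ with zero diagonal and off-diagonal entries $a_1,a_2,\dots$. For $\lambda\in\mathbb{C}$ and $j\in\{1,\dots,T\}$ put $$B_j(\lambda)=\begin{pmatrix}0&1\\ -\frac{a_{j-1}}{a_j}&\frac{\lambda}{a_j}\end{pmatrix},\qquad M(\lambda)=B_T(\lambda)B_{T-1}(\lambda)\cdots B_1(\lambda)=\begin{pmatrix}m_{11}(\lambda)&m_{12}(\lambda)\\ m_{21}(\lambda)&m_{22}(\lambda)\end{pmatrix}.$$ $\sigma_{ell}(J_T)$ is the set of elliptic points, i.e. of those $\lambda\in\mathbb{C}$ for which $M(\lambda)$ has two distinct eigenvalues of modulus one; equivalently, the set of real $\lambda$ with $|\mathrm{Tr}\,M(\lambda)|<2$. For $\lambda\in\sigma_{ell}(J_T)$ the eigenvalues of $M(\lambda)$ are $\mu(\lambda)=e^{i\theta(\lambda)}$ and $e^{-i\theta(\lambda)}$ with $\theta(\lambda)$ real (the quasi-momentum), and $m_{12}(\lambda)\ne0$. Define $(\varphi_n(\lambda))_{n\ge0}$ by $\varphi_0=1$, $\varphi_1=(\mu-m_{11})/m_{12}$ and $a_{n-1}\varphi_{n-1}+a_n\varphi_{n+1}=\lambda\varphi_n$ for $n\ge1$; it satisfies $\varphi_{T(k-1)+s}=\varphi_s e^{i(k-1)\theta(\lambda)}$ for $s\in\{0,\dots,T-1\}$,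 $k\ge1$. Further, $$C(\lambda;T)=\mathrm{Re}\left(\sum_{s=1}^{T}\varphi_s(\lambda)\overline{\varphi_{s-1}(\lambda)}\right),\qquad \omega_n(\lambda)=\sum_{m=n+1}^{\infty}m^{-\alpha}\,\mathrm{Im}(\varphi_m(\lambda))\,\mathrm{Im}(\varphi_{m-1}(\lambda)).$$ *)

theory Defs
  imports Complex_Main "HOL-Library.Landau_Symbols" "Jordan_Normal_Form.Char_Poly"
begin

text \<open>
  Throughout, \<open>a\<close> is the \<open>T\<close>-periodic sequence of off-diagonal entries of the Jacobi operator
  \<open>J\<^sub>T\<close>, whose diagonal is zero. Its value at \<open>0\<close> is the one given by periodicity,
  \<open>a 0 = a T\<close>. The operator enters only through \<open>a\<close> and \<open>T\<close>.
\<close>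

text \<open>The matrix is \<open>B\<^sub>j(lam)\<close> for \<open>j \<ge> 1\<close>; the value at \<open>j = 0\<close> is never used.\<close>

definition transfer_mat :: "(nat \<Rightarrow> real) \<Rightarrow> complex \<Rightarrow> nat \<Rightarrow> complex mat" where
  "transfer_mat a lam j = mat_of_rows_list 2
     [[0, 1],
      [- of_real (a (j - 1) / a j), lam / of_real (a j)]]"

primrec transfer_prod :: "(nat \<Rightarrow> real) \<Rightarrow> complex \<Rightarrow> nat \<Rightarrow> complex mat" where
  "transfer_prod a lam 0 = 1\<^sub>m 2"
| "transfer_prod a lam (Suc n) = transfer_mat a lam (Suc n) * transfer_prod a lam n"

definition monodromy :: "(nat \<Rightarrow> real) \<Rightarrow> nat \<Rightarrow> complex \<Rightarrow> complex mat" where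
  "monodromy a T lam = transfer_prod a lam T"

definition elliptic_points :: "(nat \<Rightarrow> real) \<Rightarrow> nat \<Rightarrow> complex set" where
  "elliptic_points a T = {lam. \<exists>z w. z \<noteq> w \<and>
     eigenvalue (monodromy a T lam) z \<and> eigenvalue (monodromy a T lam) w \<and>
     cmod z = 1 \<and> cmod w = 1}"

text \<open>A quasi-momentum is only determined up to sign and multiples of \<open>2 * pi\<close>, hence a relation.\<close>

definition quasi_momentum :: "(nat \<Rightarrow> real) \<Rightarrow> nat \<Rightarrow> complex \<Rightarrow> real \<Rightarrow> bool" where
  "quasi_momentum a T lam \<theta> \<longleftrightarrow>
     {z. eigenvalue (monodromy a T lam) z} = {exp (\<i> * of_real \<theta>), exp (- \<i> * of_real \<theta>)}"

text \<open>
  The solution with \<open>\<phi>\<^sub>0 = 1\<close> and \<open>\<phi>\<^sub>1 = (\<mu> - m\<^sub>1\<^sub>1) / m\<^sub>1\<^sub>2\<close>, where \<open>\<mu>\<close> is the exponential of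
  \<open>\<i> * \<theta>\<close>. Matrix indices start at \<open>0\<close>, so \<open>m\<^sub>1\<^sub>2\<close> is the entry \<open>(0, 1)\<close>.
\<close>

fun phi :: "(nat \<Rightarrow> real) \<Rightarrow> nat \<Rightarrow> complex \<Rightarrow> real \<Rightarrow> nat \<Rightarrow> complex" where
  "phi a T lam \<theta> 0 = 1"
| "phi a T lam \<theta> (Suc 0) =
     (exp (\<i> * of_real \<theta>) - monodromy a T lam $$ (0, 0)) / monodromy a T lam $$ (0, 1)"
| "phi a T lam \<theta> (Suc (Suc n)) =
     (lam * phi a T lam \<theta> (Suc n) - of_real (a n) * phi a T lam \<theta> n) / of_real (a (Suc n))"

lemma phi_recurrence:
  assumes "n \<ge> 1" and "a n \<noteq> 0"
  shows "of_real (a (n - 1)) * phi a T lam \<theta> (n - 1) + of_real (a n) * phi a T lam \<theta> (n + 1)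
           = lam * phi a T lam \<theta> n"
  using assms by (cases n) auto

definition C_coeff :: "(nat \<Rightarrow> real) \<Rightarrow> nat \<Rightarrow> complex \<Rightarrow> real \<Rightarrow> real" where
  "C_coeff a T lam \<theta> = Re (\<Sum>s=1..T. phi a T lam \<theta> s * cnj (phi a T lam \<theta> (s - 1)))"

text \<open>The summation index is \<open>m = n + 1 + i\<close>.\<close>

definition omega :: "(nat \<Rightarrow> real) \<Rightarrow> nat \<Rightarrow> complex \<Rightarrow> real \<Rightarrow> real \<Rightarrow> nat \<Rightarrow> real" where
  "omega a T lam \<theta> \<alpha> n =
     (\<Sum>i. real (n + 1 + i) powr (- \<alpha>) * Im (phi a T lam \<theta> (n + 1 + i)) * Im (phi a T lam \<theta> (n + i)))"

end

(* For m >= 1 write Im phi_m Im phi_(m-1) = (Re(phi_m cnj phi_(m-1)) - Re(phi_m phi_(m-1))) / 2.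
   The first term is T-periodic with mean value C/T; the second picks up the factor mu^2 over a
   period, and mu^2 is not 1, so it has bounded partial sums. Summation by parts then gives
   omega_n = C / (2 T (alpha - 1)) n^(1 - alpha) + O(n^(-alpha)), and Im phi_n is a sinusoid on each
   residue class modulo T. That mu^2 is not 1, and that m12 is not 0, rests on lam being real:
   then M is a real matrix whose eigenvalues are not real. *)
theory Submission
  imports Defs
begin

section \<open>Transfer matrices and the three-term recurrence\<close>

lemma transfer_prod_carrier: "transfer_prod a lam n \<in> carrier_mat 2 2"
  by (induction n) (auto simp: transfer_mat_def mat_of_rows_list_def)

text \<open>A transfer matrix moves the lower row up and puts the next value of the recurrence below
  it, so each column holds two consecutive values of a solution.\<close>

lemma transfer_prod_Suc_entries:
  assumes "j < 2"
  shows "transfer_prod a lam (Suc n) $$ (0, j) = transfer_prod a lam n $$ (1, j)"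
    and "transfer_prod a lam (Suc n) $$ (1, j) =
           (lam * transfer_prod a lam n $$ (1, j) - of_real (a n) * transfer_prod a lam n $$ (0, j))
             / of_real (a (Suc n))"
proof -
  have c: "transfer_prod a lam n \<in> carrier_mat 2 2"
    by (rule transfer_prod_carrier)
  show "transfer_prod a lam (Suc n) $$ (0, j) = transfer_prod a lam n $$ (1, j)"
    using c assms
    by (simp add: transfer_mat_def mat_of_rows_list_def scalar_prod_def numeral_2_eq_2)
  show "transfer_prod a lam (Suc n) $$ (1, j) =
           (lam * transfer_prod a lam n $$ (1, j) - of_real (a n) * transfer_prod a lam n $$ (0, j))
             / of_real (a (Suc n))"
    using c assms
    by (simp add: transfer_mat_def mat_of_rows_list_def scalar_prod_def numeral_2_eq_2
        diff_divide_distrib)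
qed

text \<open>The columns are the solutions with initial data \<open>(1, 0)\<close> and
  \<open>(0, 1)\<close>; linearity does the rest.\<close>

lemma transfer_prod_solution:
  assumes rec: "\<And>n. y (Suc (Suc n)) =
     (lam * y (Suc n) - of_real (a n) * y n) / of_real (a (Suc n))"
  shows "y n = transfer_prod a lam n $$ (0, 0) * y 0 + transfer_prod a lam n $$ (0, 1) * y 1 \<and>
         y (Suc n) = transfer_prod a lam n $$ (1, 0) * y 0 + transfer_prod a lam n $$ (1, 1) * y 1"
proof (induction n)
  case 0
  show ?case by simp
next
  case (Suc n)
  then show ?case
    unfolding rec[of n]
    by (simp del: transfer_prod.simps
        add: transfer_prod_Suc_entries[unfolded One_nat_def] diff_divide_distrib add_divide_distrib algebra_simps)
qed

lemma transfer_prod_real: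
  assumes "lam \<in> \<real>" "i < 2" "j < 2"
  shows "transfer_prod a lam n $$ (i, j) \<in> \<real>"
proof -
  have "\<forall>j<2. transfer_prod a lam n $$ (0, j) \<in> \<real> \<and> transfer_prod a lam n $$ (1, j) \<in> \<real>"
  proof (induction n)
    case 0
    show ?case by (auto simp: less_2_cases_iff)
  next
    case (Suc n)
    then show ?case using assms(1)
      by (auto simp del: transfer_prod.simps simp: transfer_prod_Suc_entries[unfolded One_nat_def])
  qed
  with assms show ?thesis by (auto simp: less_2_cases_iff)
qed

section \<open>Eigenvalues of two-by-two matrices\<close>

lemma eigenvalue_2x2:
  assumes A: "A \<in> carrier_mat 2 2" and ev: "eigenvalue A (z :: complex)"
  obtains v0 v1 where "(v0, v1) \<noteq> (0, 0)"
    "A $$ (0, 0) * v0 + A $$ (0, 1) * v1 = z * v0"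
    "A $$ (1, 0) * v0 + A $$ (1, 1) * v1 = z * v1"
proof -
  from ev obtain v where v: "v \<in> carrier_vec 2" "v \<noteq> 0\<^sub>v 2" "A *\<^sub>v v = z \<cdot>\<^sub>v v"
    using A by (auto simp: eigenvalue_def eigenvector_def)
  have "(A *\<^sub>v v) $ i = A $$ (i, 0) * v $ 0 + A $$ (i, 1) * v $ 1" if "i < 2" for i
    using that A v(1) by (simp add: scalar_prod_def numeral_2_eq_2)
  then have "A $$ (i, 0) * v $ 0 + A $$ (i, 1) * v $ 1 = z * v $ i" if "i < 2" for i
    using that v by simp
  moreover have "(v $ 0, v $ 1) \<noteq> (0, 0)"
    using v(1,2) by (auto simp: vec_eq_iff less_2_cases_iff)
  ultimately show ?thesis
    using that[of "v $ 0" "v $ 1"] by simp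
qed

lemma eigenvalue_2x2_char_eq:
  assumes "A \<in> carrier_mat 2 2" and "eigenvalue A (z :: complex)"
  shows "(A $$ (0, 0) - z) * (A $$ (1, 1) - z) = A $$ (0, 1) * A $$ (1, 0)"
proof -
  define p q r s where d: "p = A $$ (0, 0)" "q = A $$ (0, 1)" "r = A $$ (1, 0)" "s = A $$ (1, 1)"
  obtain v0 v1 where v: "(v0, v1) \<noteq> (0, 0)" "p * v0 + q * v1 = z * v0" "r * v0 + s * v1 = z * v1"
    using eigenvalue_2x2[OF assms] unfolding d by metis
  \<comment> \<open>This identity and the next are the two rows of the adjugate of
    \<open>A - z\<close> applied to \<open>(A - z) v\<close>; the determinant therefore kills a
    nonzero vector.\<close>
  have "((p - z) * (s - z) - q * r) * v0
      = (s - z) * (p * v0 + q * v1 - z * v0) - q * (r * v0 + s * v1 - z * v1)"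
    by (simp add: algebra_simps)
  moreover have "((p - z) * (s - z) - q * r) * v1
      = (p - z) * (r * v0 + s * v1 - z * v1) - r * (p * v0 + q * v1 - z * v0)"
    by (simp add: algebra_simps)
  ultimately have "((p - z) * (s - z) - q * r) * v0 = 0" "((p - z) * (s - z) - q * r) * v1 = 0"
    unfolding v(2,3) by simp_all
  with v(1) show ?thesis
    unfolding d[symmetric] by auto
qed

section \<open>Reality of the spectral parameter\<close>

lemma sum_shift_periodic:
  fixes f :: "nat \<Rightarrow> 'a :: comm_monoid_add"
  assumes "f T = f 0"
  shows "(\<Sum>n<T. f (Suc n)) = (\<Sum>n<T. f n)"
proof (cases T)
  case (Suc k)
  have "(\<Sum>n<Suc k. f n) = f 0 + (\<Sum>n<k. f (Suc n))"
    by (rule sum.lessThan_Suc_shift)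
  then show ?thesis
    using assms Suc by (simp add: add.commute)
qed simp

text \<open>The Bloch boundary condition makes the \<open>T\<close>-dimensional eigenvalue problem Hermitian.\<close>

lemma quasi_periodic_solution_real:
  assumes T: "T > 0" and a0: "\<And>n. a n > 0" and aT: "\<And>n. a (n + T) = a n"
    and rec: "\<And>n. y (Suc (Suc n)) =
     (lam * y (Suc n) - of_real (a n) * y n) / of_real (a (Suc n))"
    and qp: "\<And>n. y (n + T) = \<mu> * y n" and \<mu>: "cmod \<mu> = 1"
    and y: "(y 0, y 1) \<noteq> (0, 0)"
  shows "lam \<in> \<real>"
proof -
  define N where "N = (\<Sum>n<T. (cmod (y (Suc n)))\<^sup>2)"
  define f where "f n = of_real (a n) * y n * cnj (y (Suc n))" for n
  have \<mu>': "\<mu> * cnj \<mu> = 1"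
    using \<mu> by (simp add: complex_norm_square[symmetric])
  \<comment> \<open>The recurrence multiplied by \<open>cnj (y (Suc n))\<close>; its two terms are
    conjugate up to a shift, so their sums over one period are conjugate as soon as
    \<open>f T = f 0\<close>.\<close>
  have *: "lam * of_real ((cmod (y (Suc n)))\<^sup>2) = f n + cnj (f (Suc n))" for n
  proof -
    have "of_real (a (Suc n)) * y (Suc (Suc n)) = lam * y (Suc n) - of_real (a n) * y n"
      using a0[of "Suc n"] by (simp add: rec)
    then have "lam * y (Suc n) * cnj (y (Suc n)) =
      (of_real (a n) * y n + of_real (a (Suc n)) * y (Suc (Suc n))) * cnj (y (Suc n))"
      by simp
    then show ?thesis
      unfolding f_def complex_norm_square by (simp add: algebra_simps)
  qed
  have fT: "f T = f 0"
  proof -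
    have "f T = of_real (a 0) * y 0 * cnj (y (Suc 0)) * (\<mu> * cnj \<mu>)"
      using aT[of 0] qp[of 0] qp[of 1] by (simp add: f_def)
    then show ?thesis by (simp add: \<mu>' f_def)
  qed
  have "lam * of_real N = (\<Sum>n<T. f n) + (\<Sum>n<T. cnj (f (Suc n)))"
    unfolding N_def of_real_sum sum_distrib_left * sum.distrib ..
  also have "(\<Sum>n<T. cnj (f (Suc n))) = (\<Sum>n<T. cnj (f n))"
    using sum_shift_periodic[of "\<lambda>n. cnj (f n)" T] fT by simp
  also have "(\<Sum>n<T. f n) + (\<Sum>n<T. cnj (f n)) = of_real (2 * Re (\<Sum>n<T. f n))"
    by (metis cnj_sum complex_add_cnj)
  finally have lN: "lam * of_real N = of_real (2 * Re (\<Sum>n<T. f n))" .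
  \<comment> \<open>\<open>N\<close> involves only \<open>y 1, ..., y T\<close>; the value
    \<open>y 0\<close> is recovered from \<open>y T = \<mu> * y 0\<close>.\<close>
  have "N \<noteq> 0"
  proof
    assume "N = 0"
    then have z: "y (Suc n) = 0" if "n < T" for n
      using that by (simp add: N_def sum_nonneg_eq_0_iff)
    have "y T = 0" using z[of "T - 1"] T by simp
    then have "y 0 = 0" using qp[of 0] \<mu> by auto
    moreover have "y 1 = 0" using z[of 0] T by simp
    ultimately show False using y by simp
  qed
  then have "lam = of_real (2 * Re (\<Sum>n<T. f n) / N)"
    using lN by (simp add: field_simps)
  then show ?thesis by simp
qed

section \<open>Partial sums of quasi-periodic sequences\<close>

lemma bounded_of_periodic:
  fixes f :: "nat \<Rightarrow> real"
  assumes T: "T > 0" and per: "\<And>n. f (n + T) = f n"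
  shows "\<exists>B. \<forall>n. f n \<le> B"
proof -
  have *: "f n = f (n mod T)" for n
  proof -
    have "f (r + k * T) = f r" for r k
    proof (induction k)
      case (Suc k)
      then show ?case using per[of "r + k * T"] by (simp add: ac_simps)
    qed simp
    from this[of "n mod T" "n div T"] show ?thesis by simp
  qed
  have "f n \<le> Max (f ` {..<T})" for n
    unfolding *[of n] using T by (intro Max_ge) auto
  then show ?thesis by blast
qed

text \<open>
  The partial sums satisfy an affine recursion over one period, whose linear part is a rotation
  about the fixed point \<open>d\<close>. For \<open>\<rho> = 1\<close> the quotient defining \<open>d\<close> is \<open>0\<close>.
\<close>

lemma quasi_periodic_bounded_partial_sums:
  fixes f :: "nat \<Rightarrow> complex"
  assumes T: "T > 0" and qp: "\<And>n. f (n + T) = \<rho> * f n" and \<rho>: "cmod \<rho> = 1"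
    and zero: "\<rho> = 1 \<Longrightarrow> (\<Sum>n<T. f n) = 0"
  shows "\<exists>B. \<forall>k. cmod (\<Sum>n<k. f n) \<le> B"
proof -
  define S where "S k = (\<Sum>n<k. f n)" for k
  define d where "d = S T / (1 - \<rho>)"
  have "S (k + T) = S T + \<rho> * S k" for k
  proof (induction k)
    case (Suc k)
    have "S (Suc m) = S m + f m" for m
      by (simp add: S_def)
    from this[of k] this[of "k + T"] show ?case
      by (simp add: Suc qp distrib_left)
  qed (simp add: S_def)
  \<comment> \<open>For \<open>\<rho> = 1\<close> the recursion is a translation by
    \<open>S T\<close>, which \<open>zero\<close> turns into the identity.\<close>
  moreover have "d = S T + \<rho> * d"
    using zero by (cases "\<rho> = 1") (simp_all add: d_def S_def field_simps)
  ultimately have "S (k + T) - d = \<rho> * (S k - d)" for k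
    by (metis (no_types, opaque_lifting) add_diff_cancel_left right_diff_distrib)
  then have "cmod (S (k + T) - d) = cmod (S k - d)" for k
    using \<rho> by (simp add: norm_mult)
  from bounded_of_periodic[of T "\<lambda>k. cmod (S k - d)", OF T this]
  obtain B where B: "cmod (S k - d) \<le> B" for k by blast
  have "cmod (S k) \<le> B + cmod d" for k
    using B[of k] norm_triangle_sub[of "S k" d] by linarith
  then show ?thesis unfolding S_def by blast
qed

section \<open>Summation by parts and power-weighted tails\<close>

text \<open>Summation by parts puts the differences on the weights. These are nonnegative and
  telescope to \<open>b 0 - b k\<close>, and the boundary term supplies the missing
  \<open>b k\<close>.\<close>

lemma abel_summation_bound:
  fixes b g :: "nat \<Rightarrow> real"
  assumes b0: "\<And>i. b i \<ge> 0" and dec: "\<And>i. b (Suc i) \<le> b i"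
    and B: "\<And>k. \<bar>\<Sum>i<k. g i\<bar> \<le> B"
  shows "\<bar>\<Sum>i<k. b i * g i\<bar> \<le> B * b 0"
proof -
  define S where "S k = (\<Sum>i<k. g i)" for k
  have eq: "(\<Sum>i<k. b i * g i) = b k * S k + (\<Sum>i<k. (b i - b (Suc i)) * S (Suc i))"
    by (induction k) (simp_all add: S_def algebra_simps)
  have "\<bar>\<Sum>i<k. (b i - b (Suc i)) * S (Suc i)\<bar> \<le> (\<Sum>i<k. \<bar>(b i - b (Suc i)) * S (Suc i)\<bar>)"
    by (rule sum_abs)
  also have "\<dots> \<le> (\<Sum>i<k. (b i - b (Suc i)) * B)"
  proof (intro sum_mono)
    show "\<bar>(b i - b (Suc i)) * S (Suc i)\<bar> \<le> (b i - b (Suc i)) * B" for i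
      using B[of "Suc i"] dec[of i] unfolding abs_mult S_def by (intro mult_mono) simp_all
  qed
  also have "\<dots> = (b 0 - b k) * B"
    unfolding sum_distrib_right[symmetric] by (simp add: sum_lessThan_telescope')
  finally have 1: "\<bar>\<Sum>i<k. (b i - b (Suc i)) * S (Suc i)\<bar> \<le> (b 0 - b k) * B" .
  have "\<bar>b k * S k\<bar> \<le> b k * B"
    unfolding abs_mult S_def using B[of k] b0[of k] by (intro mult_mono) simp_all
  with 1 show ?thesis unfolding eq by (simp add: algebra_simps)
qed

text \<open>\<open>D\<close> is the integral of \<open>t powr (- \<alpha>)\<close> over
  \<open>[x, x + 1]\<close>. The mean value theorem for the antiderivative \<open>h\<close> makes it
  a value of this decreasing function inside the interval.\<close>

lemma powr_increment_bounds:
  fixes x \<alpha> :: real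
  assumes x: "x > 0" and \<alpha>: "\<alpha> > 1"
  defines "D \<equiv> x powr (1 - \<alpha>) / (\<alpha> - 1) - (x + 1) powr (1 - \<alpha>) / (\<alpha> - 1)"
  shows "(x + 1) powr (- \<alpha>) \<le> D" and "D \<le> x powr (- \<alpha>)"
proof -
  define h where "h t = - (t powr (1 - \<alpha>)) / (\<alpha> - 1)" for t
  have "\<exists>z>x. z < x + 1 \<and> h (x + 1) - h x = (x + 1 - x) * z powr (- \<alpha>)"
  proof (rule MVT2)
    fix t assume "x \<le> t" "t \<le> x + 1"
    with x have "t > 0" by simp
    then have "(h has_real_derivative - ((1 - \<alpha>) * t powr (1 - \<alpha> - 1)) / (\<alpha> - 1)) (at t)"
      unfolding h_def by (intro DERIV_cdivide DERIV_minus has_real_derivative_powr)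
    moreover have "- ((1 - \<alpha>) * t powr (1 - \<alpha> - 1)) / (\<alpha> - 1) = t powr (- \<alpha>)"
      using \<alpha> by (simp add: nonzero_divide_eq_eq algebra_simps)
    ultimately show "(h has_real_derivative t powr (- \<alpha>)) (at t)"
      by (rule back_subst)
  qed simp
  then obtain z where z: "x < z" "z < x + 1" "h (x + 1) - h x = z powr (- \<alpha>)" by auto
  have D: "D = z powr (- \<alpha>)" using z(3) by (simp add: D_def h_def)
  show "(x + 1) powr (- \<alpha>) \<le> D" "D \<le> x powr (- \<alpha>)"
    unfolding D using x z \<alpha> by (intro powr_mono2'; simp)+
qed

text \<open>Integral comparison: the telescoping series lies between the tail from
  \<open>n + 1\<close> and the tail from \<open>n\<close>, which differ by the single term
  \<open>real n powr (- \<alpha>)\<close>.\<close>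

lemma powr_tail:
  fixes \<alpha> :: real
  assumes n: "n \<ge> 1" and \<alpha>: "\<alpha> > 1"
  defines "b \<equiv> \<lambda>i. real (n + 1 + i) powr (- \<alpha>)"
  shows "summable b"
    and "\<bar>suminf b - real n powr (1 - \<alpha>) / (\<alpha> - 1)\<bar> \<le> real n powr (- \<alpha>)"
proof -
  define h where "h i = real (n + i) powr (1 - \<alpha>) / (\<alpha> - 1)" for i
  define c where "c i = real (n + i) powr (- \<alpha>)" for i
  have lim: "h \<longlonglongrightarrow> 0"
  proof -
    have "(\<lambda>i. real (n + i) powr (1 - \<alpha>)) \<longlonglongrightarrow> 0"
    proof (rule tendsto_neg_powr)
      show "filterlim (\<lambda>i. real (n + i)) at_top sequentially"
        by (rule filterlim_compose[OF filterlim_real_sequentially])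
          (simp add: filterlim_at_top_mono[OF filterlim_ident])
    qed (use \<alpha> in simp)
    from tendsto_divide[OF this tendsto_const[of "\<alpha> - 1"]] \<alpha> show ?thesis
      unfolding h_def by simp
  qed
  have tel: "(\<lambda>i. h i - h (Suc i)) sums h 0"
    using telescope_sums'[OF lim] by simp
  have bnd: "b i \<le> h i - h (Suc i)" "h i - h (Suc i) \<le> c i" for i
    using powr_increment_bounds[of "real (n + i)" \<alpha>] n \<alpha>
    by (simp_all add: b_def h_def c_def add_ac)
  show sb: "summable b"
    by (rule summable_comparison_test'[OF sums_summable[OF tel], of 0])
      (use bnd in \<open>simp add: b_def\<close>)
  have bc: "b = (\<lambda>i. c (Suc i))"
    by (simp add: b_def c_def fun_eq_iff)
  have sc: "summable c"
    using sb unfolding bc by (simp add: summable_Suc_iff)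
  have "suminf b \<le> h 0"
    using suminf_le[OF bnd(1) sb sums_summable[OF tel]] sums_unique[OF tel] by simp
  moreover have "h 0 \<le> suminf c"
    using suminf_le[OF bnd(2) sums_summable[OF tel] sc] sums_unique[OF tel] by simp
  moreover have "suminf c = suminf b + c 0"
    using suminf_split_head[OF sc] bc by simp
  ultimately show "\<bar>suminf b - real n powr (1 - \<alpha>) / (\<alpha> - 1)\<bar> \<le> real n powr (- \<alpha>)"
    by (simp add: h_def c_def)
qed

text \<open>The mean \<open>c\<close> of \<open>g\<close> yields the main term through the pure
  power tail. The deviation \<open>g - c\<close> has bounded partial sums, so by summation by parts
  it costs no more than a multiple of the first weight.\<close>

lemma weighted_powr_tail:
  fixes g :: "nat \<Rightarrow> real" and \<alpha> c B :: real
  assumes n: "n \<ge> 1" and \<alpha>: "\<alpha> > 1" and B: "\<And>k. \<bar>\<Sum>m<k. (g m - c)\<bar> \<le> B"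
  shows "\<bar>(\<Sum>i. real (n + 1 + i) powr (- \<alpha>) * g (n + i)) - c * real n powr (1 - \<alpha>) / (\<alpha> - 1)\<bar>
           \<le> (2 * B + \<bar>c\<bar>) * real n powr (- \<alpha>)"
proof -
  define b where "b i = real (n + 1 + i) powr (- \<alpha>)" for i
  define e where "e i = g (n + i) - c" for i
  note tail = powr_tail[OF n \<alpha>, folded b_def]
  have B0: "B \<ge> 0" using B[of 0] by simp
  \<comment> \<open>A sum starting at \<open>n\<close> is a difference of two initial sums, hence
    the factor 2.\<close>
  have part: "\<bar>\<Sum>i<k. e i\<bar> \<le> 2 * B" for k
  proof -
    have "(\<Sum>i<k. e i) = (\<Sum>m<n + k. (g m - c)) - (\<Sum>m<n. (g m - c))"
      by (induction k) (simp_all add: e_def)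
    then show ?thesis using B[of "n + k"] B[of n] by linarith
  qed
  \<comment> \<open>This crude bound serves only to show convergence of the series; the estimate
    itself uses \<open>part\<close>.\<close>
  have e_bound: "\<bar>e i\<bar> \<le> 4 * B" for i
    using part[of "Suc i"] part[of i] by simp
  have sbe: "summable (\<lambda>i. b i * e i)"
  proof (rule summable_comparison_test'[of "\<lambda>i. b i * (4 * B)" 0])
    show "norm (b i * e i) \<le> b i * (4 * B)" for i
      using e_bound[of i] by (auto simp: abs_mult b_def intro: mult_left_mono)
  qed (intro summable_mult2 tail(1))
  have "\<bar>\<Sum>i. b i * e i\<bar> \<le> 2 * B * b 0"
  proof (rule LIMSEQ_le_const2)
    show "(\<lambda>k. \<bar>\<Sum>i<k. b i * e i\<bar>) \<longlonglongrightarrow> \<bar>\<Sum>i. b i * e i\<bar>"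
      by (intro tendsto_rabs summable_LIMSEQ sbe)
    have "\<bar>\<Sum>i<k. b i * e i\<bar> \<le> 2 * B * b 0" for k
      by (rule abel_summation_bound)
        (use \<alpha> part in \<open>auto simp: b_def intro!: powr_mono2'\<close>)
    then show "\<exists>N. \<forall>k\<ge>N. \<bar>\<Sum>i<k. b i * e i\<bar> \<le> 2 * B * b 0" by blast
  qed
  also have "\<dots> \<le> 2 * B * real n powr (- \<alpha>)"
    using B0 n \<alpha> by (intro mult_left_mono) (auto simp: b_def intro!: powr_mono2')
  finally have 1: "\<bar>\<Sum>i. b i * e i\<bar> \<le> 2 * B * real n powr (- \<alpha>)" .
  have "(\<Sum>i. b i * g (n + i)) = (\<Sum>i. b i * e i + c * b i)"
    by (simp add: e_def algebra_simps)
  also have "\<dots> = (\<Sum>i. b i * e i) + c * suminf b"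
    using sbe tail(1) by (simp add: suminf_add[symmetric] suminf_mult summable_mult)
  finally have "(\<Sum>i. b i * g (n + i)) - c * real n powr (1 - \<alpha>) / (\<alpha> - 1)
      = (\<Sum>i. b i * e i) + c * (suminf b - real n powr (1 - \<alpha>) / (\<alpha> - 1))"
    by (simp add: algebra_simps)
  moreover have "\<bar>c * (suminf b - real n powr (1 - \<alpha>) / (\<alpha> - 1))\<bar> \<le> \<bar>c\<bar> * real n powr (- \<alpha>)"
    unfolding abs_mult using tail(2) by (intro mult_left_mono) auto
  ultimately show ?thesis
    using 1 unfolding b_def[symmetric] by (simp add: algebra_simps)
qed

section \<open>The Floquet multiplier of \<open>phi\<close>\<close>

text \<open>The initial data of \<open>phi\<close> form an eigenvector of the monodromy matrix for
  \<open>\<mu>\<close>, provided that its entry \<open>(0, 1)\<close> is nonzero. That in turn needs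
  \<open>lam\<close> to be real, which is first derived from a solution built on an arbitrary
  eigenvector.\<close>

lemma phi_quasi_periodic:
  assumes T: "T > 0" and a0: "\<And>n. a n > 0" and aT: "\<And>n. a (n + T) = a n"
    and ell: "lam \<in> elliptic_points a T" and qm: "quasi_momentum a T lam \<theta>"
  defines "\<mu> \<equiv> exp (\<i> * of_real \<theta>)"
  shows "phi a T lam \<theta> (n + T) = \<mu> * phi a T lam \<theta> n" and "\<mu> \<notin> \<real>"
proof -
  define M where "M = transfer_prod a lam T"
  have M: "M \<in> carrier_mat 2 2" unfolding M_def by (rule transfer_prod_carrier)
  have mono: "monodromy a T lam = M" by (simp add: monodromy_def M_def)
  have evs: "{z. eigenvalue M z} = {\<mu>, exp (- \<i> * of_real \<theta>)}"
    using qm by (simp add: quasi_momentum_def mono \<mu>_def)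
  have cnj\<mu>: "exp (- \<i> * of_real \<theta>) = cnj \<mu>"
    by (simp add: \<mu>_def cis_cnj flip: cis_conv_exp of_real_minus mult_minus_right)
  have norm\<mu>: "cmod \<mu> = 1" by (simp add: \<mu>_def)
  have ev: "eigenvalue M \<mu>" using evs by blast
  have ev_iff: "eigenvalue M z \<longleftrightarrow> z = \<mu> \<or> z = cnj \<mu>" for z
    using evs unfolding cnj\<mu> set_eq_iff by simp
  \<comment> \<open>Ellipticity supplies two distinct eigenvalues, and \<open>\<mu>\<close> and
    \<open>cnj \<mu>\<close> are the only candidates.\<close>
  have "\<mu> \<noteq> cnj \<mu>"
    using ell unfolding elliptic_points_def mem_Collect_eq mono ev_iff by auto
  then show nr: "\<mu> \<notin> \<real>" by (auto simp: Reals_cnj_iff)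
  \<comment> \<open>Stated for a general solution because it is applied twice: to the auxiliary
    \<open>P\<close> and to \<open>phi\<close>.\<close>
  have propagate: "y (n + T) = \<mu> * y n"
    if rec: "\<And>n. y (Suc (Suc n)) = (lam * y (Suc n) - of_real (a n) * y n) / of_real (a (Suc n))"
      and e0: "M $$ (0, 0) * y 0 + M $$ (0, 1) * y 1 = \<mu> * y 0"
      and e1: "M $$ (1, 0) * y 0 + M $$ (1, 1) * y 1 = \<mu> * y 1" for y n
  proof -
    have "y (n + T) = \<mu> * y n \<and> y (Suc n + T) = \<mu> * y (Suc n)"
    proof (induction n)
      case 0
      show ?case
        using transfer_prod_solution[of y lam a T, OF rec] e0 e1 by (simp add: M_def)
    next
      case (Suc n)
      then show ?case
        using rec[of "n + T"] aT[of n] aT[of "Suc n"]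
        by (simp add: rec[of n] algebra_simps)
    qed
    then show ?thesis ..
  qed
  obtain v0 v1 where v: "(v0, v1) \<noteq> (0, 0)" "M $$ (0, 0) * v0 + M $$ (0, 1) * v1 = \<mu> * v0"
    "M $$ (1, 0) * v0 + M $$ (1, 1) * v1 = \<mu> * v1"
    using eigenvalue_2x2[OF M ev] by metis
  \<comment> \<open>The solution with initial data \<open>(v0, v1)\<close>. It replaces
    \<open>phi\<close>, whose definition divides by an entry not yet known to be nonzero.\<close>
  define P where "P n = transfer_prod a lam n $$ (0, 0) * v0 + transfer_prod a lam n $$ (0, 1) * v1" for n
  have P: "P 0 = v0" "P 1 = v1"
    by (simp_all add: P_def transfer_prod_Suc_entries[unfolded One_nat_def] del: transfer_prod.simps(2))
  have Prec: "P (Suc (Suc n)) = (lam * P (Suc n) - of_real (a n) * P n) / of_real (a (Suc n))" for n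
    by (simp del: transfer_prod.simps add: P_def transfer_prod_Suc_entries[unfolded One_nat_def]
        diff_divide_distrib add_divide_distrib algebra_simps)
  have "lam \<in> \<real>"
    using quasi_periodic_solution_real[of T a P lam \<mu>] T a0 aT Prec propagate[OF Prec] v P norm\<mu>
    by simp
  then have Mreal: "M $$ (i, j) \<in> \<real>" if "i < 2" "j < 2" for i j
    using that transfer_prod_real by (simp add: M_def)
  have char: "(M $$ (0, 0) - \<mu>) * (M $$ (1, 1) - \<mu>) = M $$ (0, 1) * M $$ (1, 0)"
    by (rule eigenvalue_2x2_char_eq[OF M ev])
  \<comment> \<open>Otherwise the characteristic equation makes \<open>\<mu>\<close> equal to a
    diagonal entry, which is real.\<close>
  have m12: "M $$ (0, 1) \<noteq> 0"
  proof
    assume "M $$ (0, 1) = 0"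
    with char have "\<mu> = M $$ (0, 0) \<or> \<mu> = M $$ (1, 1)" by auto
    with nr Mreal show False by auto
  qed
  show "phi a T lam \<theta> (n + T) = \<mu> * phi a T lam \<theta> n"
  proof (rule propagate)
    show "M $$ (0, 0) * phi a T lam \<theta> 0 + M $$ (0, 1) * phi a T lam \<theta> 1 = \<mu> * phi a T lam \<theta> 0"
      using m12 by (simp add: mono \<mu>_def)
    \<comment> \<open>The characteristic equation is the second row of the eigenvector equation
      multiplied by \<open>M $$ (0, 1)\<close>.\<close>
    have "M $$ (1, 0) * M $$ (0, 1) + M $$ (1, 1) * (\<mu> - M $$ (0, 0)) = \<mu> * (\<mu> - M $$ (0, 0))"
      using char by (simp add: algebra_simps)
    then have "M $$ (1, 0) + M $$ (1, 1) * ((\<mu> - M $$ (0, 0)) / M $$ (0, 1))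
        = \<mu> * ((\<mu> - M $$ (0, 0)) / M $$ (0, 1))"
      using m12 by (simp add: field_simps)
    then show "M $$ (1, 0) * phi a T lam \<theta> 0 + M $$ (1, 1) * phi a T lam \<theta> 1 = \<mu> * phi a T lam \<theta> 1"
      by (simp add: mono \<mu>_def)
  qed simp
qed

section \<open>Mean and oscillation of products of imaginary parts\<close>

lemma Im_mult_Im: "Im z * Im w = (Re (z * cnj w) - Re (z * w)) / 2"
  by simp

text \<open>Both halves of the product have bounded partial sums for the same reason:
  \<open>p\<close> has multiplier 1 and zero sum over a period, \<open>q\<close> has multiplier
  \<open>\<mu>\<^sup>2\<close>.\<close>

lemma quasi_periodic_Im_product_partial_sums:
  fixes f :: "nat \<Rightarrow> complex"
  assumes T: "T > 0" and qp: "\<And>n. f (n + T) = \<mu> * f n" and \<mu>: "cmod \<mu> = 1" "\<mu> \<notin> \<real>"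
  defines "C \<equiv> Re (\<Sum>s<T. f (Suc s) * cnj (f s))"
  shows "\<exists>B. \<forall>k. \<bar>\<Sum>m<k. (Im (f (Suc m)) * Im (f m) - C / (2 * real T))\<bar> \<le> B"
proof -
  define p where "p m = complex_of_real (Re (f (Suc m) * cnj (f m)) - C / real T)" for m
  define q where "q m = f (Suc m) * f m" for m
  have \<mu>\<mu>: "\<mu> * cnj \<mu> = 1"
    using \<mu>(1) by (simp add: complex_norm_square[symmetric])
  have "\<exists>B. \<forall>k. cmod (\<Sum>m<k. p m) \<le> B"
  proof (rule quasi_periodic_bounded_partial_sums[OF T])
    fix n
    have "f (Suc (n + T)) * cnj (f (n + T)) = f (Suc n) * cnj (f n) * (\<mu> * cnj \<mu>)"
      using qp[of "Suc n"] qp[of n] by simp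
    then show "p (n + T) = 1 * p n"
      by (simp only: p_def \<mu>\<mu> mult_1_right mult_1_left)
  next
    show "(\<Sum>n<T. p n) = 0"
      unfolding p_def of_real_sum[symmetric] sum_subtractf C_def using T by simp
  qed simp
  then obtain B1 where B1: "\<And>k. cmod (\<Sum>m<k. p m) \<le> B1" by blast
  have "\<exists>B. \<forall>k. cmod (\<Sum>m<k. q m) \<le> B"
  proof (rule quasi_periodic_bounded_partial_sums[OF T])
    show "q (n + T) = \<mu>\<^sup>2 * q n" for n
      using qp[of "Suc n"] qp[of n] by (simp add: q_def power2_eq_square)
    show "cmod (\<mu>\<^sup>2) = 1" using \<mu>(1) by (simp add: norm_power)
    \<comment> \<open>A contradictory case: \<open>\<mu>\<close> would be 1 or -1, hence
      real.\<close>
    show "(\<Sum>n<T. q n) = 0" if "\<mu>\<^sup>2 = 1"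
      using that \<mu>(2) by (auto simp: power2_eq_1_iff)
  qed
  then obtain B2 where B2: "\<And>k. cmod (\<Sum>m<k. q m) \<le> B2" by blast
  have "\<bar>\<Sum>m<k. (Im (f (Suc m)) * Im (f m) - C / (2 * real T))\<bar> \<le> (B1 + B2) / 2" for k
  proof -
    have "(\<Sum>m<k. (Im (f (Suc m)) * Im (f m) - C / (2 * real T)))
        = (\<Sum>m<k. (Re (p m) - Re (q m)) / 2)"
      unfolding Im_mult_Im p_def q_def by (intro sum.cong refl) (simp add: field_simps)
    also have "\<dots> = (Re (\<Sum>m<k. p m) - Re (\<Sum>m<k. q m)) / 2"
      by (simp only: sum_divide_distrib[symmetric] sum_subtractf Re_sum)
    finally have eq: "(\<Sum>m<k. (Im (f (Suc m)) * Im (f m) - C / (2 * real T)))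
        = (Re (\<Sum>m<k. p m) - Re (\<Sum>m<k. q m)) / 2" .
    have "\<bar>Re (\<Sum>m<k. p m)\<bar> \<le> B1" "\<bar>Re (\<Sum>m<k. q m)\<bar> \<le> B2"
      using B1[of k] B2[of k] abs_Re_le_cmod order_trans by blast+
    then show ?thesis
      unfolding eq by (simp add: abs_le_iff)
  qed
  then show ?thesis by blast
qed

theorem theorem5p4:
  fixes a :: "nat \<Rightarrow> real" and T :: nat and lam :: complex and \<theta> \<alpha> :: real
  assumes "T \<ge> 1"
    and "\<And>n. a n > 0"
    and "\<And>n. a (n + T) = a n"
    and "lam \<in> elliptic_points a T"
    and "quasi_momentum a T lam \<theta>"
    and "\<alpha> > 1"
  shows "\<exists>\<eta> \<zeta> :: nat \<Rightarrow> real.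
    (\<lambda>n. Im (phi a T lam \<theta> n) * omega a T lam \<theta> \<alpha> n
         - \<eta> (n mod T) * sin (real n * \<theta> / real T + \<zeta> (n mod T)) / real n powr (\<alpha> - 1))
      \<in> O(\<lambda>n. 1 / real n powr \<alpha>) \<and>
    (\<exists>v :: nat \<Rightarrow> real. (\<exists>s<T. v s \<noteq> 0) \<and> (\<forall>s<T. \<eta> s = C_coeff a T lam \<theta> * v s)) \<and>
    ((\<forall>s<T. \<eta> s = 0) \<longrightarrow> C_coeff a T lam \<theta> = 0)"
proof -
  define f where "f = phi a T lam \<theta>"
  define C where "C = C_coeff a T lam \<theta>"
  define \<mu> where "\<mu> = exp (\<i> * of_real \<theta>)"
  \<comment> \<open>The factors come from the amplitude of \<open>Im (f n)\<close>, the mean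
    \<open>C / (2 * real T)\<close> of the products, and the power tail with its
    \<open>\<alpha> - 1\<close>.\<close>
  define v where "v s = cmod (f s) / (2 * real T * (\<alpha> - 1))" for s
  define \<eta> where "\<eta> s = C * v s" for s
  \<comment> \<open>For \<open>n = s + k * T\<close> the phase of \<open>f n\<close> is
    \<open>k * \<theta> + Arg (f s)\<close>, while \<open>n * \<theta> / T\<close> already contains
    \<open>s * \<theta> / T\<close>; the latter is subtracted.\<close>
  define \<zeta> where "\<zeta> s = Arg (f s) - real s * \<theta> / real T" for s
  have T: "T > 0" using assms(1) by simp
  have qp: "f (n + T) = \<mu> * f n" for n
    unfolding f_def \<mu>_def by (rule phi_quasi_periodic) (fact T assms)+
  have nr: "\<mu> \<notin> \<real>"
    unfolding \<mu>_def by (rule phi_quasi_periodic) (fact T assms)+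
  have norm\<mu>: "cmod \<mu> = 1" by (simp add: \<mu>_def)
  have C: "C = Re (\<Sum>s<T. f (Suc s) * cnj (f s))"
    unfolding C_def C_coeff_def f_def
    by (rule arg_cong[of _ _ Re], rule sum.reindex_bij_witness[of _ Suc "\<lambda>s. s - 1"]) auto
  obtain B where B: "\<And>k. \<bar>\<Sum>m<k. (Im (f (Suc m)) * Im (f m) - C / (2 * real T))\<bar> \<le> B"
    using quasi_periodic_Im_product_partial_sums[of T f \<mu>, OF T qp norm\<mu> nr] unfolding C by blast
  define K where "K = 2 * B + \<bar>C / (2 * real T)\<bar>"
  have "cmod (f (n + T)) = cmod (f n)" for n
    by (simp add: qp norm_mult norm\<mu>)
  from bounded_of_periodic[of T "\<lambda>n. cmod (f n)", OF T this]
  obtain F where F: "\<And>n. cmod (f n) \<le> F" by blast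
  have polar: "Im (f n) = cmod (f (n mod T)) * sin (real n * \<theta> / real T + \<zeta> (n mod T))" for n
  proof -
    define r k where "r = n mod T" and "k = n div T"
    have n: "n = r + k * T" by (simp add: r_def k_def)
    have "f (r + k * T) = \<mu> ^ k * f r"
    proof (induction k)
      case (Suc k)
      then show ?case using qp[of "r + k * T"] by (simp add: ac_simps)
    qed simp
    also have "\<mu> ^ k = cis (real k * \<theta>)"
      by (simp add: \<mu>_def cis_conv_exp[symmetric] DeMoivre)
    \<comment> \<open>This includes \<open>f r = 0\<close>: the amplitude is then 0 and the value of
      \<open>Arg\<close> is immaterial.\<close>
    also have "cis (real k * \<theta>) * f r = rcis (cmod (f r)) (real k * \<theta> + Arg (f r))"
      by (metis cis_rcis_eq mult_1 rcis_cmod_Arg rcis_mult)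
    finally have "Im (f n) = cmod (f r) * sin (real k * \<theta> + Arg (f r))"
      by (simp add: n)
    moreover have "real k * \<theta> + Arg (f r) = real n * \<theta> / real T + \<zeta> r"
      using T by (simp add: \<zeta>_def n field_simps)
    ultimately show ?thesis by (simp add: r_def)
  qed
  have bound: "\<bar>Im (f n) * omega a T lam \<theta> \<alpha> n
         - \<eta> (n mod T) * sin (real n * \<theta> / real T + \<zeta> (n mod T)) / real n powr (\<alpha> - 1)\<bar>
      \<le> F * K * (1 / real n powr \<alpha>)" if n: "n \<ge> 1" for n
  proof -
    define E where "E = omega a T lam \<theta> \<alpha> n - C / (2 * real T) * real n powr (1 - \<alpha>) / (\<alpha> - 1)"
    have "\<bar>E\<bar> \<le> K * real n powr (- \<alpha>)"
      using weighted_powr_tail[of n \<alpha> "\<lambda>m. Im (f (Suc m)) * Im (f m)" "C / (2 * real T)" B,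
          OF n assms(6) B]
      by (simp add: E_def K_def omega_def f_def mult.assoc)
    moreover have "\<bar>Im (f n)\<bar> \<le> F"
      using abs_Im_le_cmod[of "f n"] F[of n] by linarith
    ultimately have "\<bar>Im (f n) * E\<bar> \<le> F * (K * real n powr (- \<alpha>))"
      unfolding abs_mult by (intro mult_mono) auto
    \<comment> \<open>The leading term is exactly \<open>Im (f n)\<close> times the main term of
      \<open>omega\<close>, so \<open>Im (f n) * E\<close> is the entire error.\<close>
    moreover have "\<eta> (n mod T) * sin (real n * \<theta> / real T + \<zeta> (n mod T)) / real n powr (\<alpha> - 1)
        = Im (f n) * (C / (2 * real T) * real n powr (1 - \<alpha>) / (\<alpha> - 1))"
      using powr_minus_divide[of "real n" "\<alpha> - 1"] by (simp add: \<eta>_def v_def polar ac_simps)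
    ultimately show ?thesis
      by (simp add: E_def algebra_simps powr_minus_divide)
  qed
  \<comment> \<open>\<open>f 0 = 1\<close>, so index 0 witnesses that \<open>v\<close> is nonzero,
    and \<open>\<eta> 0 = 0\<close> forces \<open>C = 0\<close>.\<close>
  have v0: "v 0 \<noteq> 0"
    using T assms(6) by (simp add: v_def f_def)
  have "(\<lambda>n. Im (f n) * omega a T lam \<theta> \<alpha> n
         - \<eta> (n mod T) * sin (real n * \<theta> / real T + \<zeta> (n mod T)) / real n powr (\<alpha> - 1))
      \<in> O(\<lambda>n. 1 / real n powr \<alpha>)"
    by (rule bigoI[of _ "F * K"], rule eventually_sequentiallyI[of 1]) (use bound in simp)
  moreover have "\<exists>s<T. v s \<noteq> 0" "\<forall>s<T. \<eta> s = C * v s" "(\<forall>s<T. \<eta> s = 0) \<longrightarrow> C = 0"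
    using v0 T by (auto simp: \<eta>_def)
  ultimately show ?thesis
    unfolding f_def C_def by blast
qed

end
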